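(* Let $V$ be a finite nonempty set and $f:\{0,1\}^V\to\{0,1\}^V$. Then $f$ is positive-circular if and only if $f$ is a 2-critical and-net.
   Context: For nonempty $I\subseteq V$ and $z\in\{0,1\}^{V\setminus I}$, the subnetwork of $f$ induced by $z$ is $h:\{0,1\}^I\to\{0,1\}^I$ with $h(x|_I)=f(x)|_I$ for all $x$ whose restriction to $V\setminus I$ is $z$; a strict subnetwork is one different from $f$. $f$ is 2-critical if it has at least two fixed points and every strict subnetwork has at most one fixed point. For $x^{j\alpha}$ the point equal to $x$ except its $j$-component is $\alpha$, the global interaction graph $G(f)$ is the signed digraph on $V$ with a positive (resp. negative) arc from $j$ to $i$ iff $f_i(x^{j1})-f_i(x^{j0})=1$ (resp. $=-1$) for at least one $x$. $f$ is an and-net if $G(f)$ has at most one arc from $j$ to $i$ for all $i,j$ and for every $i$ and $x$: $f_i(x)=1$ iff $G(f)$ has no positive arc $j\to i$ with $x_j=0$ and no negative arc $j\to i$ with $x_j=1$. A cycle is a subgraph with at most one arc between any ordered pair whose underlying unsigned digraph is a directed cycle; positive if it has an even number of negative arcs. $f$ is positive-circular if $G(f)$ itself is a positive cycle through all vertices of $V$. *)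

theory Defs
  imports Main
begin

text \<open>Boolean networks on a finite vertex type 'v (V = UNIV).
  A configuration x in {0,1}^V is a map 'v => bool (True = 1).\<close>

type_synonym 'v bnet = "('v \<Rightarrow> bool) \<Rightarrow> ('v \<Rightarrow> bool)"

definition fixed_points :: "'v bnet \<Rightarrow> ('v \<Rightarrow> bool) set" where
  "fixed_points f = {x. f x = x}"

text \<open>Fixed points of the subnetwork h of f on I induced by z (only z outside I matters).
  A configuration y in {0,1}^I is represented by a map 'v => bool that is False outside I.
  h(y) = f(x)|_I where x agrees with y on I and with z outside I.\<close>

definition subnet_fixed_points :: "'v bnet \<Rightarrow> 'v set \<Rightarrow> ('v \<Rightarrow> bool) \<Rightarrow> ('v \<Rightarrow> bool) set" where
  "subnet_fixed_points f I z =
     {y. (\<forall>v. v \<notin> I \<longrightarrow> y v = False) \<and>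
         (\<forall>i\<in>I. f (\<lambda>v. if v \<in> I then y v else z v) i = y i)}"

text \<open>Strict subnetworks are exactly those with I a nonempty proper subset of V
  (for I = V the induced subnetwork is f itself; otherwise its domain differs).\<close>

definition two_critical :: "('v::finite) bnet \<Rightarrow> bool" where
  "two_critical f \<longleftrightarrow> card (fixed_points f) \<ge> 2 \<and>
     (\<forall>I z. I \<noteq> {} \<and> I \<noteq> UNIV \<longrightarrow> card (subnet_fixed_points f I z) \<le> 1)"

definition pos_arc :: "'v bnet \<Rightarrow> 'v \<Rightarrow> 'v \<Rightarrow> bool" where
  "pos_arc f j i \<longleftrightarrow> (\<exists>x. f (x(j := True)) i \<and> \<not> f (x(j := False)) i)"

definition neg_arc :: "'v bnet \<Rightarrow> 'v \<Rightarrow> 'v \<Rightarrow> bool" where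
  "neg_arc f j i \<longleftrightarrow> (\<exists>x. \<not> f (x(j := True)) i \<and> f (x(j := False)) i)"

definition and_net :: "'v bnet \<Rightarrow> bool" where
  "and_net f \<longleftrightarrow> (\<forall>i j. \<not> (pos_arc f j i \<and> neg_arc f j i)) \<and>
     (\<forall>i x. f x i \<longleftrightarrow>
        (\<not> (\<exists>j. pos_arc f j i \<and> \<not> x j) \<and> \<not> (\<exists>j. neg_arc f j i \<and> x j)))"

definition positive_circular :: "('v::finite) bnet \<Rightarrow> bool" where
  "positive_circular f \<longleftrightarrow>
     (\<forall>i j. \<not> (pos_arc f j i \<and> neg_arc f j i)) \<and>
     (\<exists>vs. distinct vs \<and> set vs = UNIV \<and>
        {(j, i). pos_arc f j i \<or> neg_arc f j i} =
          {(vs ! k, vs ! ((k + 1) mod length vs)) | k. k < length vs}) \<and>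
     even (card {(j, i). neg_arc f j i})"

end

theory Submission
  imports Defs
begin

text \<open>
  If a network is positive-circular, every coordinate is a copy or a negation of its predecessor, so
  a configuration is determined along the cycle by a single value; evenness makes exactly the two
  propagated configurations close up, and freezing a vertex leaves no freedom.

  Conversely, let \<open>x \<noteq> y\<close> be fixed points of a 2-critical and-net. They differ everywhere, since
  otherwise the coordinates where they differ carry a strict subnetwork with two fixed points. Hence
  the arc from \<open>j\<close> to \<open>i\<close> is positive iff \<open>x\<^sub>j = x\<^sub>i\<close>. Let \<open>A = {i. x\<^sub>i = 1}\<close>. Criticality says: for every
  nonempty proper \<open>I\<close> inducing a subgraph of minimum in-degree at least one, some vertex outside \<open>I\<close>
  has out-neighbours both in \<open>I \<inter> A\<close> and in \<open>I - A\<close>; otherwise the outside can be frozen so that \<open>x\<close>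
  and \<open>y\<close> both restrict to fixed points on \<open>I\<close>.

  Let \<open>forced v\<close> be the set of vertices whose value is forced by \<open>v\<close>, i.e. the least set containing \<open>v\<close>
  and every vertex all of whose in-neighbours lie in the set. If \<open>forced r\<close> is everything, then the graph
  without the arcs into \<open>r\<close> is acyclic, and walking back from \<open>r\<close> through in-neighbours of least rank
  gives a cycle such that every vertex outside it has at most one out-neighbour on it; so it is the
  whole graph. Otherwise take \<open>forced w\<close> of maximal size, and grow it by adding vertices of \<open>A\<close> with some
  in-neighbour, and vertices outside \<open>A\<close> with all in-neighbours, in the current set. By criticality
  this exhausts the graph. The last vertex \<open>v\<close> added satisfies \<open>forced v = {v}\<close>, so by criticality it has
  an out-neighbour \<open>b \<noteq> v\<close> outside \<open>A\<close>, which can only be \<open>w\<close>. Thus \<open>w \<notin> A\<close>, and exchanging \<open>A\<close> with its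
  complement, \<open>w \<in> A\<close>, a contradiction.
\<close>

section \<open>Critical digraphs\<close>

inductive_set forced :: "('v \<Rightarrow> 'v \<Rightarrow> bool) \<Rightarrow> 'v \<Rightarrow> 'v set"
  for E :: "'v \<Rightarrow> 'v \<Rightarrow> bool" and v :: 'v where
  root: "v \<in> forced E v"
| step: "(\<And>y. E y x \<Longrightarrow> y \<in> forced E v) \<Longrightarrow> x \<in> forced E v"

text \<open>Vertices enter one at a time, so inverting a derivation of \<open>UNIV\<close> exposes
  the last vertex added.\<close>

inductive grown :: "('v \<Rightarrow> 'v \<Rightarrow> bool) \<Rightarrow> 'v set \<Rightarrow> 'v set \<Rightarrow> 'v set \<Rightarrow> bool"
  for E :: "'v \<Rightarrow> 'v \<Rightarrow> bool" and A D :: "'v set" where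
  base: "grown E A D D"
| some_pred: "grown E A D Y \<Longrightarrow> v \<notin> Y \<Longrightarrow> v \<in> A \<Longrightarrow> E y v \<Longrightarrow> y \<in> Y \<Longrightarrow> grown E A D (insert v Y)"
| all_preds: "grown E A D Y \<Longrightarrow> v \<notin> Y \<Longrightarrow> v \<notin> A \<Longrightarrow> (\<And>y. E y v \<Longrightarrow> y \<in> Y) \<Longrightarrow> grown E A D (insert v Y)"

text \<open>Signs are not recorded: in the application \<open>A\<close> is the support of a fixed
  point, and an arc is positive iff its ends lie on the same side of \<open>A\<close>.\<close>

locale critical_digraph =
  fixes E :: "'v::finite \<Rightarrow> 'v \<Rightarrow> bool" and A :: "'v set"
  assumes ex_pred: "\<exists>j. E j i"
    and conflict: "I \<noteq> {} \<Longrightarrow> I \<noteq> UNIV \<Longrightarrow> (\<And>i. i \<in> I \<Longrightarrow> \<exists>j\<in>I. E j i) \<Longrightarrow>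
      \<exists>w a b. w \<notin> I \<and> a \<in> I \<inter> A \<and> b \<in> I - A \<and> E w a \<and> E w b"
begin

lemma swap_colours: "critical_digraph E (- A)"
proof
  show "\<exists>j. E j i" for i by (rule ex_pred)
next
  fix I :: "'v set"
  assume "I \<noteq> {}" "I \<noteq> UNIV" "\<And>i. i \<in> I \<Longrightarrow> \<exists>j\<in>I. E j i"
  from conflict[OF this]
  show "\<exists>w a b. w \<notin> I \<and> a \<in> I \<inter> - A \<and> b \<in> I - - A \<and> E w a \<and> E w b"
    by blast
qed

section \<open>Forced sets\<close>

lemma forced_pred:
  assumes "x \<in> forced E v" "x \<noteq> v" "E y x"
  shows "y \<in> forced E v"
  using assms by (cases rule: forced.cases) auto

lemma forced_trans: "x \<in> forced E u \<Longrightarrow> u \<in> forced E v \<Longrightarrow> x \<in> forced E v"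
  by (induction rule: forced.induct) (auto intro: forced.step)

text \<open>A common element other than \<open>u\<close> differs from \<open>v\<close> too, so it
  passes membership in both sets on to an in-neighbour, and one exists. Induction leads back to
  \<open>u\<close>, which is not in \<open>forced E v\<close>.\<close>

lemma forced_disjoint:
  assumes "v \<notin> forced E u" "u \<notin> forced E v"
  shows "forced E u \<inter> forced E v = {}"
proof -
  have "x \<notin> forced E v" if "x \<in> forced E u" for x
    using that
  proof (induction rule: forced.induct)
    case root
    show ?case by fact
  next
    case (step x)
    then have "x \<in> forced E u" by (blast intro: forced.step)
    then have "x \<noteq> v" using assms by blast
    obtain y where "E y x" using ex_pred by blast
    then show ?case using step \<open>x \<noteq> v\<close> forced_pred by blast
  qed
  then show ?thesis by blast
qed

text \<open>A vertex outside the set has an in-neighbour outside, or it would be forced; hence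
  \<open>conflict\<close> applies to the complement.\<close>

lemma forced_conflict:
  assumes "forced E v \<noteq> UNIV"
  obtains w a b where "w \<in> forced E v" "a \<notin> forced E v" "b \<notin> forced E v"
    "a \<in> A" "b \<notin> A" "E w a" "E w b"
proof -
  have "\<exists>w a b. w \<notin> - forced E v \<and> a \<in> - forced E v \<inter> A \<and> b \<in> - forced E v - A \<and> E w a \<and> E w b"
    by (rule conflict) (use assms forced.root[of v E] forced.step[of E _ v] in blast)+
  with that show thesis by blast
qed

section \<open>Growing a set according to the colours\<close>

lemma grown_base_subset: "grown E A D Y \<Longrightarrow> D \<subseteq> Y"
  by (induction rule: grown.induct) auto

lemma grown_pred:
  "grown E A D Y \<Longrightarrow> b \<in> Y \<Longrightarrow> b \<notin> A \<Longrightarrow> b \<notin> D \<Longrightarrow> E y b \<Longrightarrow> y \<in> Y"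
  by (induction rule: grown.induct) auto

text \<open>By either rule the new vertex has an in-neighbour in \<open>Y\<close>. If it lay in
  \<open>forced E u\<close> without being \<open>u\<close>, that in-neighbour would be there as
  well.\<close>

lemma grown_forced_disjoint:
  "grown E A D Y \<Longrightarrow> u \<notin> Y \<Longrightarrow> forced E u \<inter> D = {} \<Longrightarrow> forced E u \<inter> Y = {}"
proof (induction rule: grown.induct)
  case (some_pred Y v y)
  then show ?case using forced_pred[of v u y] by blast
next
  case (all_preds Y v)
  obtain y where "E y v" using ex_pred by blast
  with all_preds show ?case using forced_pred[of v u y] by blast
qed simp

text \<open>If \<open>Y\<close> is stuck, every vertex outside it has an in-neighbour outside. Then
  \<open>conflict\<close>, applied to the complement, gives an arc from \<open>Y\<close> to an
  outside vertex of \<open>A\<close>, which could have been added.\<close>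

lemma grown_extend:
  assumes "grown E A D Y" "D \<noteq> {}" "Y \<noteq> UNIV"
  shows "\<exists>v. v \<notin> Y \<and> grown E A D (insert v Y)"
proof (rule ccontr)
  assume *: "\<not> ?thesis"
  then have A: "\<not> E y v" if "v \<notin> Y" "v \<in> A" "y \<in> Y" for v y
    using that assms(1) grown.some_pred by metis
  have B: "\<exists>y. E y v \<and> y \<notin> Y" if "v \<notin> Y" "v \<notin> A" for v
    using that assms(1) * grown.all_preds by metis
  have "Y \<noteq> {}" using assms grown_base_subset by blast
  moreover have "\<exists>j\<in>- Y. E j i" if "i \<in> - Y" for i
    using that A B ex_pred by (metis ComplD ComplI)
  ultimately have "\<exists>w a b. w \<notin> - Y \<and> a \<in> - Y \<inter> A \<and> b \<in> - Y - A \<and> E w a \<and> E w b"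
    using assms(3) by (intro conflict) auto
  then show False using A by blast
qed

lemma grown_UNIV:
  assumes "D \<noteq> {}"
  shows "grown E A D UNIV"
proof -
  have "grown E A D Y \<Longrightarrow> grown E A D UNIV" for Y
  proof (induction "card (- Y)" arbitrary: Y rule: less_induct)
    case less
    show ?case
    proof (cases "Y = UNIV")
      case False
      then obtain v where v: "v \<notin> Y" "grown E A D (insert v Y)"
        using grown_extend less.prems assms by blast
      have "card (- insert v Y) < card (- Y)"
        by (rule psubset_card_mono) (use v in auto)
      then show ?thesis using less v by blast
    qed (use less in simp)
  qed
  then show ?thesis using grown.base by blast
qed

lemma maximal_forced_colour:
  assumes max: "\<And>v. card (forced E v) \<le> card (forced E w)"
    and proper: "forced E w \<noteq> UNIV"
  shows "w \<notin> A"
proof -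
  let ?D = "forced E w"
  have "?D \<noteq> {}" using forced.root[of w E] by blast
  from grown_UNIV[OF this] obtain v Y where vY: "grown E A ?D Y" "v \<notin> Y" "UNIV = insert v Y"
    by (cases rule: grown.cases) (use proper in auto)
  have D: "?D \<subseteq> Y" using grown_base_subset vY(1) .
  \<comment> \<open>Otherwise \<open>forced E v\<close> would contain \<open>?D\<close> and also
    \<open>v\<close>, against maximality.\<close>
  have "w \<notin> forced E v"
  proof
    assume "w \<in> forced E v"
    then have "?D \<subset> forced E v"
      using forced_trans forced.root[of v E] D vY(2) by blast
    then show False
      using psubset_card_mono[of "forced E v" ?D] max[of v] by simp
  qed
  then have "forced E v \<inter> ?D = {}"
    using forced_disjoint[of w v] D vY(2) by blast
  then have "forced E v \<inter> Y = {}"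
    using grown_forced_disjoint vY by blast
  then have v: "forced E v = {v}"
    using vY(3) forced.root[of v E] by blast
  then have "forced E v \<noteq> UNIV"
    using \<open>w \<notin> forced E v\<close> by blast
  then obtain b where b: "b \<noteq> v" "b \<notin> A" "E v b"
    by (rule forced_conflict) (use v in auto)
  then have "b \<in> Y" using vY(3) by blast
  \<comment> \<open>Outside \<open>?D\<close>, \<open>b\<close> would have entered with all its
    in-neighbours in \<open>Y\<close>; inside \<open>?D\<close> but distinct from \<open>w\<close>,
    it would have them in \<open>?D\<close>. Either way \<open>v\<close> would lie in
    \<open>Y\<close>.\<close>
  then have "b \<in> ?D" using grown_pred vY b by blast
  then have "b = w" using forced_pred b D vY(2) by blast
  then show ?thesis using b by blast
qed

lemma ex_forced_UNIV: "\<exists>r. forced E r = UNIV"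
proof (rule ccontr)
  assume *: "\<nexists>r. forced E r = UNIV"
  have "finite (range (\<lambda>v. card (forced E v)))" by simp
  then have "Max (range (\<lambda>v. card (forced E v))) \<in> range (\<lambda>v. card (forced E v))"
    by (rule Max_in) simp
  then obtain w where w: "card (forced E w) = Max (range (\<lambda>v. card (forced E v)))"
    by (metis imageE)
  have max: "card (forced E v) \<le> card (forced E w)" for v
    unfolding w by (rule Max_ge) auto
  have "w \<notin> A" "w \<notin> - A"
    using * maximal_forced_colour[OF max]
      critical_digraph.maximal_forced_colour[OF swap_colours max] by blast+
  then show False by blast
qed

section \<open>Ranks and extraction of the cycle\<close>

lemma ex_rank:
  assumes "forced E r = UNIV"
  obtains \<rho> :: "'v \<Rightarrow> nat" where "\<And>x y. E y x \<Longrightarrow> x \<noteq> r \<Longrightarrow> \<rho> y < \<rho> x"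
proof -
  define R where "R = {(y, x). E y x \<and> x \<noteq> r}"
  have "x \<in> Wellfounded.acc R" if "x \<in> forced E r" for x
    using that by (induction rule: forced.induct) (auto simp: R_def intro: acc.intros)
  then have "wf R" using assms by (intro acc_wfI) auto
  have acyc: "(x, x) \<notin> R\<^sup>+" for x using wf_acyclic[OF \<open>wf R\<close>] by (simp add: acyclic_def)
  show thesis
  proof
    fix x y assume "E y x" "x \<noteq> r"
    then have yx: "(y, x) \<in> R" by (simp add: R_def)
    \<comment> \<open>The rank is the number of proper ancestors once the arcs into \<open>r\<close>
      are deleted.\<close>
    show "card {z. (z, y) \<in> R\<^sup>+} < card {z. (z, x) \<in> R\<^sup>+}"
    proof (rule psubset_card_mono)
      have "{z. (z, y) \<in> R\<^sup>+} \<subseteq> {z. (z, x) \<in> R\<^sup>+}"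
        using yx by (auto intro: trancl_into_trancl)
      moreover have "y \<in> {z. (z, x) \<in> R\<^sup>+} - {z. (z, y) \<in> R\<^sup>+}"
        using yx acyc by auto
      ultimately show "{z. (z, y) \<in> R\<^sup>+} \<subset> {z. (z, x) \<in> R\<^sup>+}" by blast
    qed simp
  qed
qed

lemma ex_cycle:
  "\<exists>vs. distinct vs \<and> set vs = UNIV \<and>
     {(j, i). E j i} = {(vs ! k, vs ! ((k + 1) mod length vs)) | k. k < length vs}"
proof -
  obtain r where r: "forced E r = UNIV" using ex_forced_UNIV by blast
  obtain \<rho> :: "'v \<Rightarrow> nat" where \<rho>: "\<And>x y. E y x \<Longrightarrow> x \<noteq> r \<Longrightarrow> \<rho> y < \<rho> x"
    using ex_rank[OF r] by blast
  have "\<exists>y. E y x \<and> (\<forall>z. E z x \<longrightarrow> \<rho> y \<le> \<rho> z)" for x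
    using ex_has_least_nat[of "\<lambda>y. E y x" _ \<rho>] ex_pred[of x] by blast
  then obtain p where p: "\<And>x. E (p x) x" and p_le: "\<And>x z. E z x \<Longrightarrow> \<rho> (p x) \<le> \<rho> z"
    by metis
  have reach: "\<exists>k. (p ^^ k) x = r" for x
  proof (induction "\<rho> x" arbitrary: x rule: less_induct)
    case less
    show ?case
    proof (cases "x = r")
      case True
      then have "(p ^^ 0) x = r" by simp
      then show ?thesis by blast
    next
      case False
      then obtain k where "(p ^^ k) (p x) = r" using less \<rho> p by blast
      then have "(p ^^ Suc k) x = r" by (simp add: funpow_swap1)
      then show ?thesis by blast
    qed
  qed
  define L where "L = (LEAST k. 0 < k \<and> (p ^^ k) r = r)"
  obtain k where "(p ^^ k) (p r) = r" using reach by blast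
  then have "0 < Suc k \<and> (p ^^ Suc k) r = r" by (simp add: funpow_swap1)
  then have L: "0 < L" "(p ^^ L) r = r"
    unfolding L_def by (rule LeastI2; simp)+
  have L_min: "(p ^^ k) r \<noteq> r" if "0 < k" "k < L" for k
    using that not_less_Least[of k "\<lambda>k. 0 < k \<and> (p ^^ k) r = r"] unfolding L_def by blast
  \<comment> \<open>Arcs into \<open>r\<close> give no rank inequality, hence \<open>0 < k\<close>.
    Index \<open>L\<close> is allowed: \<open>r\<close> is compared as the end of the walk, not as
    its start.\<close>
  have dec: "\<rho> ((p ^^ m) r) < \<rho> ((p ^^ k) r)" if "0 < k" "k < m" "m \<le> L" for k m
    using that(2,3)
  proof (induction m)
    case (Suc m)
    then have "\<rho> ((p ^^ Suc m) r) < \<rho> ((p ^^ m) r)"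
      using \<rho>[OF p] L_min[of m] that(1) by simp
    then show ?case using Suc by (cases "k = m") auto
  qed simp
  define c where "c = (\<lambda>k. (p ^^ k) r)"
  have c0: "c 0 = r" and cL: "c L = r" and cS: "c (Suc k) = p (c k)" for k
    using L by (auto simp: c_def)
  have c_r: "c k \<noteq> r" if "0 < k" "k < L" for k using L_min that by (simp add: c_def)
  have c_dec: "\<rho> (c m) < \<rho> (c k)" if "0 < k" "k < m" "m \<le> L" for k m
    using dec that by (simp add: c_def)
  define I where "I = c ` {..<L}"
  \<comment> \<open>The arc to \<open>c k\<close> ranks \<open>w\<close> at least as high as
    \<open>c (Suc k)\<close>, by the minimal choice of \<open>p\<close>; the arc to
    \<open>c m\<close> ranks it strictly below \<open>c m\<close>, which is no higher than
    \<open>c (Suc k)\<close>.\<close>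
  have off: "\<not> (E w (c k) \<and> E w (c m))" if w: "w \<notin> I" and km: "k < m" "m < L" for w k m
  proof
    assume "E w (c k) \<and> E w (c m)"
    then have 1: "\<rho> (c (Suc k)) \<le> \<rho> w" and 2: "\<rho> w < \<rho> (c m)"
      using p_le cS \<rho> c_r km by auto
    have "\<rho> (c m) \<le> \<rho> (c (Suc k))"
      using c_dec[of "Suc k" m] km by (cases "m = Suc k") auto
    then show False using 1 2 by simp
  qed
  have "I = UNIV"
  proof (rule ccontr)
    assume "I \<noteq> UNIV"
    moreover have "I \<noteq> {}" using L by (auto simp: I_def)
    moreover have "\<exists>j\<in>I. E j i" if i: "i \<in> I" for i
    proof -
      obtain k where k: "k < L" "i = c k" using i by (auto simp: I_def)
      have "c (Suc k) \<in> I"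
      proof (cases "Suc k < L")
        case False
        then have "Suc k = L" using k by simp
        then have "c (Suc k) = c 0" using c0 cL by simp
        then show ?thesis using L(1) unfolding I_def by blast
      qed (auto simp: I_def)
      then show ?thesis using cS p k by auto
    qed
    ultimately obtain w a b where
      *: "w \<notin> I" "a \<in> I" "b \<in> I" "a \<noteq> b" "E w a" "E w b"
      using conflict[of I] by blast
    then obtain k m where "a = c k" "b = c m" "k < L" "m < L" by (auto simp: I_def)
    then show False using off[of w k m] off[of w m k] * by (cases k m rule: linorder_cases) auto
  qed
  have unique: "w = p x" if "E w x" for w x
  proof -
    obtain k where k: "k < L" "x = c k" using \<open>I = UNIV\<close> by (auto simp: I_def)
    \<comment> \<open>Here \<open>r\<close> is indexed by \<open>L\<close>, so that
      \<open>c_dec\<close> covers every position of \<open>w\<close>.\<close>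
    obtain m where m: "0 < m" "m \<le> L" "w = c m"
    proof -
      obtain m where "m < L" "w = c m" using \<open>I = UNIV\<close> by (auto simp: I_def)
      then show thesis using that[of m] that[of L] L c0 cL by (cases "m = 0") auto
    qed
    consider "m \<le> k" | "m = Suc k" | "Suc k < m" by linarith
    then show ?thesis
    proof cases
      case 1
      then have "\<rho> w < \<rho> x" using \<rho>[OF that] c_r[of k] k m by simp
      moreover have "\<rho> x \<le> \<rho> w" using c_dec[of m k] 1 k m by (cases "m = k") auto
      ultimately show ?thesis by simp
    next
      case 3
      then have "\<rho> w < \<rho> (p x)" using c_dec[of "Suc k" m] k m cS by auto
      then show ?thesis using p_le[OF that] by simp
    qed (use k m cS in simp)
  qed
  \<comment> \<open>The map \<open>p\<close> walks against the arcs, so the list runs through the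
    walk backwards, from \<open>c L\<close>, which is \<open>r\<close>.\<close>
  define vs where "vs = map (\<lambda>k. c (L - k)) [0..<L]"
  have len: "length vs = L" by (simp add: vs_def)
  have nth: "vs ! k = c (L - k)" if "k < L" for k using that by (simp add: vs_def)
  have nth_Suc: "vs ! ((k + 1) mod L) = c (L - Suc k)" if "k < L" for k
  proof (cases "Suc k = L")
    case True
    then show ?thesis using nth[of 0] c0 cL L(1) by simp
  qed (use nth[of "Suc k"] that in simp)
  have "inj_on (\<lambda>k. c (L - k)) {0..<L}"
  proof (rule linorder_inj_onI)
    fix k m assume "k < m" "k \<in> {0..<L}" "m \<in> {0..<L}"
    then show "c (L - k) \<noteq> c (L - m)" using c_dec[of "L - m" "L - k"] by fastforce
  qed auto
  then have "distinct vs" by (simp add: vs_def distinct_map)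
  moreover have all: "\<exists>k<L. x = c (L - Suc k)" for x
  proof -
    obtain k where "k < L" "x = c k" using \<open>I = UNIV\<close> by (auto simp: I_def)
    then show ?thesis by (intro exI[of _ "L - Suc k"]) auto
  qed
  moreover have "set vs = UNIV"
  proof -
    have "x \<in> set vs" for x
    proof -
      obtain k where "k < L" "x = c (L - Suc k)" using all by blast
      then have "x = vs ! ((k + 1) mod L)" "(k + 1) mod L < length vs"
        using nth_Suc len by auto
      then show ?thesis by auto
    qed
    then show ?thesis by blast
  qed
  moreover have "{(j, i). E j i} = {(vs ! k, vs ! ((k + 1) mod length vs)) | k. k < length vs}"
  proof -
    have pred: "p (c (L - Suc k)) = c (L - k)" if "k < L" for k
      using cS[of "L - Suc k"] that by (simp add: Suc_diff_Suc)
    have "E j i \<longleftrightarrow> (\<exists>k<L. j = vs ! k \<and> i = vs ! ((k + 1) mod L))" for i j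
    proof
      assume "E j i"
      then show "\<exists>k<L. j = vs ! k \<and> i = vs ! ((k + 1) mod L)"
        using all[of i] unique[of j i] nth nth_Suc pred by auto
    next
      assume "\<exists>k<L. j = vs ! k \<and> i = vs ! ((k + 1) mod L)"
      then show "E j i" using p nth nth_Suc pred by metis
    qed
    then show ?thesis unfolding len by auto
  qed
  ultimately show ?thesis by blast
qed

end

section \<open>Signs along a cycle\<close>

definition neg_count :: "(nat \<Rightarrow> bool) \<Rightarrow> nat \<Rightarrow> nat" where
  "neg_count \<sigma> m = card {k. k < m \<and> \<sigma> k}"

lemma neg_count_0 [simp]: "neg_count \<sigma> 0 = 0"
  by (simp add: neg_count_def)

lemma neg_count_Suc [simp]: "neg_count \<sigma> (Suc m) = neg_count \<sigma> m + (if \<sigma> m then 1 else 0)"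
proof -
  have "{k. k < Suc m \<and> \<sigma> k} = {k. k < m \<and> \<sigma> k} \<union> (if \<sigma> m then {m} else {})"
    by (auto simp: less_Suc_eq)
  then show ?thesis by (simp add: neg_count_def)
qed

lemma propagate_signs:
  assumes "\<And>k. k < m \<Longrightarrow> x (Suc k) \<longleftrightarrow> (x k \<noteq> \<sigma> k)"
  shows "x m \<longleftrightarrow> (x 0 \<noteq> odd (neg_count \<sigma> m))"
  using assms by (induction m) auto

text \<open>The vertices being distinct, an arc of the cycle is determined by the position of its
  tail.\<close>

lemma card_cycle_arcs:
  assumes "distinct vs"
    and arcs: "{(j, i). Q j i \<or> N j i} = {(vs ! k, vs ! ((k + 1) mod length vs)) | k. k < length vs}"
  shows "card {(j, i). N j i} = neg_count (\<lambda>k. N (vs ! k) (vs ! ((k + 1) mod length vs))) (length vs)"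
proof -
  let ?g = "\<lambda>k. (vs ! k, vs ! ((k + 1) mod length vs))"
  have "{(j, i). N j i} = ?g ` {k. k < length vs \<and> N (vs ! k) (vs ! ((k + 1) mod length vs))}"
  proof -
    have "\<exists>k<length vs. j = vs ! k \<and> i = vs ! ((k + 1) mod length vs)" if "N j i" for i j
    proof -
      have "(j, i) \<in> {(j, i). Q j i \<or> N j i}" using that by simp
      then show ?thesis unfolding arcs by blast
    qed
    then show ?thesis by fastforce
  qed
  moreover have "inj_on ?g {k. k < length vs \<and> N (vs ! k) (vs ! ((k + 1) mod length vs))}"
    using assms(1) by (auto simp: inj_on_def nth_eq_iff_index_eq)
  ultimately show ?thesis by (simp add: card_image neg_count_def)
qed

section \<open>Boolean networks\<close>

text \<open>Turn \<open>x\<close> into \<open>y\<close> one coordinate at a time: a coordinate where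
  they differ is not the source of an arc into \<open>i\<close>, so no change affects the
  value.\<close>

lemma depends_only_on_arcs:
  fixes f :: "'v::finite bnet"
  assumes "\<And>j. pos_arc f j i \<or> neg_arc f j i \<Longrightarrow> x j = y j"
  shows "f x i = f y i"
  using assms
proof (induction "card {j. x j \<noteq> y j}" arbitrary: x rule: less_induct)
  case less
  show ?case
  proof (cases "x = y")
    case False
    then obtain j where j: "x j \<noteq> y j" by blast
    have "{k. (x(j := y j)) k \<noteq> y k} \<subset> {k. x k \<noteq> y k}" using j by auto
    then have "card {k. (x(j := y j)) k \<noteq> y k} < card {k. x k \<noteq> y k}"
      by (intro psubset_card_mono) auto
    then have "f (x(j := y j)) i = f y i"
      by (rule less.hyps) (use less.prems in \<open>simp add: fun_upd_def\<close>)
    moreover have "f (x(j := True)) i = f (x(j := False)) i"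
      using less.prems j unfolding pos_arc_def neg_arc_def by blast
    then have "f (x(j := y j)) i = f (x(j := x j)) i" by (cases "x j"; cases "y j") auto
    ultimately show ?thesis by simp
  qed simp
qed

lemma two_critical_iff:
  fixes f :: "'v::finite bnet"
  shows "two_critical f \<longleftrightarrow> (\<exists>x y. x \<noteq> y \<and> f x = x \<and> f y = y) \<and>
    (\<forall>I z. I \<noteq> {} \<and> I \<noteq> UNIV \<longrightarrow>
      (\<forall>y\<in>subnet_fixed_points f I z. \<forall>y'\<in>subnet_fixed_points f I z. y = y'))"
proof -
  have le: "card S \<le> 1 \<longleftrightarrow> (\<forall>y\<in>S. \<forall>y'\<in>S. y = y')" for S :: "('v \<Rightarrow> bool) set"
    using card_le_Suc0_iff_eq[of S] by simp
  have "2 \<le> card (fixed_points f) \<longleftrightarrow> \<not> card (fixed_points f) \<le> 1" by linarith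
  then show ?thesis unfolding two_critical_def le by (auto simp: fixed_points_def)
qed

text \<open>The two fixed points are given as full configurations, which need not vanish outside \<open>I\<close>.\<close>

lemma two_critical_subnet_unique:
  fixes f :: "'v::finite bnet"
  assumes "two_critical f" "I \<noteq> UNIV"
    and "\<And>v. v \<notin> I \<Longrightarrow> x v = y v"
    and "\<And>i. i \<in> I \<Longrightarrow> f x i = x i" "\<And>i. i \<in> I \<Longrightarrow> f y i = y i"
  shows "x = y"
proof (cases "I = {}")
  case False
  let ?r = "\<lambda>u v. v \<in> I \<and> u v"
  have "(\<lambda>v. if v \<in> I then ?r x v else x v) = x" "(\<lambda>v. if v \<in> I then ?r y v else x v) = y"
    using assms(3) by auto
  then have "?r x \<in> subnet_fixed_points f I x" "?r y \<in> subnet_fixed_points f I x"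
    using assms(4,5) by (auto simp: subnet_fixed_points_def)
  then have "?r x = ?r y"
    using assms(1,2) False unfolding two_critical_iff by blast
  then show ?thesis using assms(3) by (auto simp: fun_eq_iff)
qed (use assms(3) in auto)

section \<open>From 2-critical and-nets to positive cycles\<close>

lemma two_critical_and_net_imp_positive_circular:
  fixes f :: "'v::finite bnet"
  assumes crit: "two_critical f" and "and_net f"
  shows "positive_circular f"
proof -
  have one_sign: "\<not> (pos_arc f j i \<and> neg_arc f j i)" for i j
    using assms(2) by (simp add: and_net_def)
  have f: "f u i \<longleftrightarrow> (\<forall>j. (pos_arc f j i \<longrightarrow> u j) \<and> (neg_arc f j i \<longrightarrow> \<not> u j))" for u i
    using assms(2) unfolding and_net_def by blast
  obtain x y where xy: "x \<noteq> y" "f x = x" "f y = y"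
    using crit unfolding two_critical_iff by blast
  have "{v. x v \<noteq> y v} = UNIV"
  proof (rule ccontr)
    assume "{v. x v \<noteq> y v} \<noteq> UNIV"
    then have "x = y"
      by (rule two_critical_subnet_unique[OF crit]) (simp_all add: xy(2,3))
    with xy(1) show False ..
  qed
  then have y: "y v \<longleftrightarrow> \<not> x v" for v by blast
  define E where "E = (\<lambda>j i. pos_arc f j i \<or> neg_arc f j i)"
  \<comment> \<open>These are the fixed-point equations of \<open>x\<close> and of its negation
    \<open>y\<close>. The one with a true left side fixes the sign of every arc into
    \<open>i\<close>; the other shows that such an arc exists.\<close>
  have sat: "x i \<longleftrightarrow> (\<forall>j. (pos_arc f j i \<longrightarrow> x j) \<and> (neg_arc f j i \<longrightarrow> \<not> x j))"
    "\<not> x i \<longleftrightarrow> (\<forall>j. (pos_arc f j i \<longrightarrow> \<not> x j) \<and> (neg_arc f j i \<longrightarrow> x j))" for i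
    using f[of x i] f[of y i] xy y by auto
  have ex: "\<exists>j. E j i" for i using sat[of i] unfolding E_def by blast
  have neg: "neg_arc f j i \<longleftrightarrow> E j i \<and> x j \<noteq> x i" 
    and pos: "pos_arc f j i \<longleftrightarrow> E j i \<and> x j = x i" for i j
    using sat[of i] one_sign[of j i] unfolding E_def by blast+
  have f': "f u i \<longleftrightarrow> (\<forall>j. E j i \<longrightarrow> (u j \<longleftrightarrow> (x j = x i)))" for u i
    unfolding f neg pos by blast
  interpret critical_digraph E "{i. x i}"
  proof
    show "\<exists>j. E j i" for i by (rule ex)
  next
    fix I :: "'v set"
    assume I: "I \<noteq> {}" "I \<noteq> UNIV" "\<And>i. i \<in> I \<Longrightarrow> \<exists>j\<in>I. E j i"
    show "\<exists>w a b. w \<notin> I \<and> a \<in> I \<inter> {i. x i} \<and> b \<in> I - {i. x i} \<and> E w a \<and> E w b"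
    proof (rule ccontr)
      assume none: "\<not> ?thesis"
      \<comment> \<open>Without a conflict, the out-neighbours of \<open>w\<close> in
        \<open>I\<close> lie on one side of \<open>{i. x i}\<close>, so one value of
        \<open>w\<close> satisfies all its arcs into \<open>I\<close>. On \<open>I\<close> only the
        arcs from within \<open>I\<close> then matter.\<close>
      define z where "z = (\<lambda>w. x w \<longleftrightarrow> (\<exists>a\<in>I. x a \<and> E w a))"
      have z: "z w \<longleftrightarrow> (x w \<longleftrightarrow> x i)" if "w \<notin> I" "i \<in> I" "E w i" for w i
        using none that unfolding z_def by blast
      define X where "X = (\<lambda>v. if v \<in> I then x v else z v)"
      define Y where "Y = (\<lambda>v. if v \<in> I then \<not> x v else z v)"
      have fX: "f X i = X i" if "i \<in> I" for i
        using z[of _ i] I(3)[OF that] that unfolding f' X_def by auto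
      have fY: "f Y i = Y i" if "i \<in> I" for i
        using z[of _ i] I(3)[OF that] that unfolding f' Y_def by auto
      have "X = Y"
        by (rule two_critical_subnet_unique[OF crit I(2) _ fX fY]) (auto simp: X_def Y_def)
      moreover obtain i where "i \<in> I" using I by blast
      ultimately show False unfolding X_def Y_def by metis
    qed
  qed
  obtain vs where vs: "distinct vs" "set vs = UNIV"
    "{(j, i). E j i} = {(vs ! k, vs ! ((k + 1) mod length vs)) | k. k < length vs}"
    using ex_cycle by blast
  let ?n = "length vs"
  let ?\<sigma> = "\<lambda>k. neg_arc f (vs ! k) (vs ! ((k + 1) mod ?n))"
  have arc: "E (vs ! k) (vs ! ((k + 1) mod ?n))" if "k < ?n" for k
  proof -
    have "(vs ! k, vs ! ((k + 1) mod ?n)) \<in> {(j, i). E j i}" unfolding vs(3) using that by blast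
    then show ?thesis by simp
  qed
  \<comment> \<open>Both ends are the same vertex: one full turn restores the value, so the number
    of sign changes is even.\<close>
  have "x (vs ! (?n mod ?n)) \<longleftrightarrow> (x (vs ! (0 mod ?n)) \<noteq> odd (neg_count ?\<sigma> ?n))"
    by (rule propagate_signs[where x = "\<lambda>k. x (vs ! (k mod ?n))"]) (use arc neg in auto)
  then have "even (neg_count ?\<sigma> ?n)" by (cases "x (vs ! 0)") simp_all
  then have "even (card {(j, i). neg_arc f j i})"
    using card_cycle_arcs[OF vs(1) vs(3)[unfolded E_def]] by simp
  then show ?thesis
    unfolding positive_circular_def using one_sign vs unfolding E_def by blast
qed

section \<open>From positive cycles to 2-critical and-nets\<close>

lemma positive_circular_imp_two_critical_and_net:
  fixes f :: "'v::finite bnet"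
  assumes "positive_circular f"
  shows "two_critical f \<and> and_net f"
proof -
  have one_sign: "\<not> (pos_arc f j i \<and> neg_arc f j i)" for i j
    using assms by (simp add: positive_circular_def)
  obtain vs where vs: "distinct vs" "set vs = UNIV"
    "{(j, i). pos_arc f j i \<or> neg_arc f j i} =
      {(vs ! k, vs ! ((k + 1) mod length vs)) | k. k < length vs}"
    using assms unfolding positive_circular_def by blast
  let ?n = "length vs"
  \<comment> \<open>Reducing the index makes \<open>c k\<close> to \<open>c (Suc k)\<close> an arc
    at the wrap-around too.\<close>
  define c where "c = (\<lambda>k. vs ! (k mod ?n))"
  define \<sigma> where "\<sigma> = (\<lambda>k. neg_arc f (vs ! k) (vs ! ((k + 1) mod ?n)))"
  have even: "even (neg_count \<sigma> ?n)"
    using assms card_cycle_arcs[OF vs(1,3)] by (simp add: positive_circular_def \<sigma>_def)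
  have n: "0 < ?n" using vs(2) by (cases vs) auto
  have c: "\<exists>k<?n. v = c k" for v
    using vs(2) by (metis UNIV_I c_def in_set_conv_nth mod_less)
  have c_inj: "k = m" if "c k = c m" "k < ?n" "m < ?n" for k m
    using that vs(1) by (simp add: c_def nth_eq_iff_index_eq)
  have c_wrap: "c ?n = c 0" by (simp add: c_def)
  have arc: "pos_arc f j i \<or> neg_arc f j i \<longleftrightarrow> (\<exists>k<?n. j = c k \<and> i = c (Suc k))" for i j
  proof -
    have "pos_arc f j i \<or> neg_arc f j i \<longleftrightarrow> (j, i) \<in> {(j, i). pos_arc f j i \<or> neg_arc f j i}"
      by simp
    also have "\<dots> \<longleftrightarrow> (\<exists>k<?n. j = vs ! k \<and> i = vs ! ((k + 1) mod ?n))"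
      unfolding vs(3) by blast
    also have "\<dots> \<longleftrightarrow> (\<exists>k<?n. j = c k \<and> i = c (Suc k))"
      by (rule ex_cong1) (auto simp: c_def)
    finally show ?thesis .
  qed
  have c_Suc_inj: "k = m" if "c (Suc k) = c (Suc m)" "k < ?n" "m < ?n" for k m
  proof (cases "Suc k = ?n"; cases "Suc m = ?n")
    assume "Suc k = ?n" "Suc m \<noteq> ?n"
    then show ?thesis using c_inj[of 0 "Suc m"] that c_wrap n by auto
  next
    assume "Suc k \<noteq> ?n" "Suc m = ?n"
    then show ?thesis using c_inj[of "Suc k" 0] that c_wrap n by auto
  qed (use that c_inj[of "Suc k" "Suc m"] in auto)
  have arc_c: "pos_arc f j (c (Suc k)) \<or> neg_arc f j (c (Suc k)) \<longleftrightarrow> j = c k" if "k < ?n" for j k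
    unfolding arc using c_Suc_inj that by blast
  have \<sigma>: "neg_arc f (c k) (c (Suc k)) \<longleftrightarrow> \<sigma> k" if "k < ?n" for k
    using that by (simp add: \<sigma>_def c_def)
  have f: "f u (c (Suc k)) \<longleftrightarrow> (u (c k) \<noteq> \<sigma> k)" if k: "k < ?n" for u k
  proof -
    let ?j = "c k" and ?i = "c (Suc k)"
    \<comment> \<open>Only \<open>?j\<close> has an arc into \<open>?i\<close>, so the value
      \<open>u ?j\<close> can be put into any configuration witnessing the sign of that arc.\<close>
    have dep: "f u ?i = f (u'(?j := u ?j)) ?i" for u'
      by (rule depends_only_on_arcs[of f ?i u "u'(?j := u ?j)"]) (use arc_c[OF k] in auto)
    show ?thesis
    proof (cases "\<sigma> k")
      case True
      then have "neg_arc f ?j ?i" using \<sigma>[OF k] by blast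
      then obtain u' where "\<not> f (u'(?j := True)) ?i" "f (u'(?j := False)) ?i"
        unfolding neg_arc_def by (elim exE conjE)
      then show ?thesis using dep[of u'] True by (cases "u ?j") auto
    next
      case False
      then have "pos_arc f ?j ?i" using \<sigma>[OF k] arc_c[OF k] by blast
      then obtain u' where "f (u'(?j := True)) ?i" "\<not> f (u'(?j := False)) ?i"
        unfolding pos_arc_def by (elim exE conjE)
      then show ?thesis using dep[of u'] False by (cases "u ?j") auto
    qed
  qed
  have c_Suc: "\<exists>k<?n. v = c (Suc k)" for v
  proof -
    obtain m where m: "m < ?n" "v = c m" using c by blast
    show ?thesis
    proof (cases m)
      case 0
      then show ?thesis using m n c_wrap by (intro exI[of _ "?n - 1"]) auto
    next
      case (Suc k)
      then show ?thesis using m by (intro exI[of _ k]) auto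
    qed
  qed
  have "and_net f"
    unfolding and_net_def
  proof (intro conjI allI)
    fix i u
    obtain k where k: "k < ?n" "i = c (Suc k)" using c_Suc by blast
    have "pos_arc f j i \<longleftrightarrow> j = c k \<and> \<not> \<sigma> k" "neg_arc f j i \<longleftrightarrow> j = c k \<and> \<sigma> k" for j
      using arc_c[OF k(1), of j] \<sigma>[OF k(1)] one_sign[of j i] unfolding k(2) by auto
    then show "f u i \<longleftrightarrow> (\<not> (\<exists>j. pos_arc f j i \<and> \<not> u j) \<and> \<not> (\<exists>j. neg_arc f j i \<and> u j))"
      using f[OF k(1)] k(2) by auto
  qed (use one_sign in blast)
  moreover have "two_critical f"
    unfolding two_critical_iff
  proof (intro conjI allI impI ballI)
    define idx where "idx = (\<lambda>v. THE k. k < ?n \<and> v = c k)"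
    have idx: "idx (c k) = k" if "k < ?n" for k
      unfolding idx_def by (rule the_equality) (use that c_inj in auto)
    define x where "x = (\<lambda>v. odd (neg_count \<sigma> (idx v)))"
    \<comment> \<open>At \<open>k = ?n\<close> the vertex is \<open>c 0\<close>; evenness of the
      full count closes the cycle.\<close>
    have xc: "x (c k) \<longleftrightarrow> odd (neg_count \<sigma> k)" if "k \<le> ?n" for k
      using that idx[of k] idx[of 0] n even c_wrap by (cases "k = ?n") (auto simp: x_def)
    have x: "x (c (Suc k)) \<longleftrightarrow> (x (c k) \<noteq> \<sigma> k)" if "k < ?n" for k
      using xc[of k] xc[of "Suc k"] that by auto
    have "f x v = x v" "f (\<lambda>v. \<not> x v) v = (\<not> x v)" for v
      using c_Suc[of v] f x by auto
    then show "\<exists>x y. x \<noteq> y \<and> f x = x \<and> f y = y"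
      by (intro exI[of _ x] exI[of _ "\<lambda>v. \<not> x v"]) (auto simp: fun_eq_iff)
  next
    fix I z y y'
    assume I: "I \<noteq> {} \<and> I \<noteq> UNIV"
      and y: "y \<in> subnet_fixed_points f I z" "y' \<in> subnet_fixed_points f I z"
    \<comment> \<open>Inside \<open>I\<close> both values are computed from the predecessor; outside
      \<open>I\<close> both are \<open>False\<close> by the encoding.\<close>
    have step: "y (c (Suc k)) = y' (c (Suc k))" if "y (c k) = y' (c k)" "k < ?n" for k
    proof (cases "c (Suc k) \<in> I")
      case True
      then have "f (\<lambda>v. if v \<in> I then y v else z v) (c (Suc k)) = y (c (Suc k))"
        "f (\<lambda>v. if v \<in> I then y' v else z v) (c (Suc k)) = y' (c (Suc k))"
        using y unfolding subnet_fixed_points_def by blast+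
      then show ?thesis unfolding f[OF that(2)] using that(1) by (simp split: if_splits)
    qed (use y in \<open>auto simp: subnet_fixed_points_def\<close>)
    have walk: "y (c m) = y' (c m)" if "y (c k) = y' (c k)" "k \<le> m" "m \<le> ?n" for k m
      using that(2,3) by (induction m rule: dec_induct) (use that(1) step in auto)
    obtain v where "v \<notin> I" using I by blast
    moreover obtain k where "k < ?n" "v = c k" using c by blast
    ultimately have "y (c k) = y' (c k)" using y by (auto simp: subnet_fixed_points_def)
    \<comment> \<open>Agreement at a frozen vertex is carried to \<open>c ?n\<close>, which is
      \<open>c 0\<close>, and from there around the whole cycle.\<close>
    then have "y (c 0) = y' (c 0)" using walk[of k ?n] \<open>k < ?n\<close> c_wrap by simp
    then have "y (c m) = y' (c m)" if "m < ?n" for m using walk[of 0 m] that by simp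
    then show "y = y'" by (intro ext) (use c in metis)
  qed
  ultimately show ?thesis by blast
qed

theorem theorem11:
  fixes f :: "('v::finite \<Rightarrow> bool) \<Rightarrow> ('v \<Rightarrow> bool)"
  shows "positive_circular f \<longleftrightarrow> (two_critical f \<and> and_net f)"
  using positive_circular_imp_two_critical_and_net two_critical_and_net_imp_positive_circular
  by blast

end
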